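(* Let $n \geq 2$ and let $D=(d_1,\dots,d_n) \in [m]^n$ be a demand profile. Then \[ p_{\textsc{Cluster}}(D) = \Theta\Big(\min\Big(1, \frac{n\|D\|_1}{m}\Big)\Big). \]
   Context: Fix $m\in\mathbb N$ and the universe of IDs $[m]=\{1,\dots,m\}$. An ID-generation algorithm $\mathcal A$ is a probability distribution over permutations of $[m]$: an instance of $\mathcal A$ draws a permutation and answers its $t$-th request with the $t$-th entry. A demand profile $D=(d_1,\dots,d_n)\in[m]^n$ means that $n$ instances of $\mathcal A$ with independent randomness are run and instance $i$ receives $d_i$ requests (one at a time, without knowing $d_i$ in advance). A collision occurs if the sets of IDs output by the $n$ instances are not pairwise disjoint; $p_{\mathcal A}(D)$ denotes the probability of a collision. $\|D\|_1=\sum_i d_i$. Algorithm Cluster: pick $x\in[m]$ uniformly at random and return IDs in the order $x, x+1, x+2,\dots$, all taken modulo $m$ (within $[m]$). Asymptotic notation is non-asymptotic: $f=O(g)$ means there is an absolute constant $c>0$, independent of all parameters (including $m$, $n$, $D$), with $f\le c\, g$ for all parameter values; $\Omega$ is the reverse inequality and $\Theta$ means both. *)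

theory Defs
  imports "HOL-Probability.Probability" "HOL-Combinatorics.Permutations"
    "HOL-Number_Theory.Cong"
begin

text \<open>A permutation \<open>\<pi>\<close> of \<open>[m] = {1..m}\<close> answers the \<open>t\<close>-th request
  (\<open>t = 1, \<dots>, m\<close>) with the ID \<open>\<pi> t\<close>.\<close>

definition id_algorithm :: "nat \<Rightarrow> (nat \<Rightarrow> nat) pmf \<Rightarrow> bool" where
  "id_algorithm m A \<longleftrightarrow> (\<forall>\<pi>\<in>set_pmf A. \<pi> permutes {1..m})"

definition issued_ids :: "(nat \<Rightarrow> nat) \<Rightarrow> nat \<Rightarrow> nat set" where
  "issued_ids \<pi> d = \<pi> ` {1..d}"

text \<open>Only the values \<open>D 1, \<dots>, D n\<close> of a demand profile matter;
  \<open>\<omega> i\<close> is the permutation drawn by instance \<open>i\<close>.\<close>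

definition collision :: "nat \<Rightarrow> (nat \<Rightarrow> nat) \<Rightarrow> (nat \<Rightarrow> nat \<Rightarrow> nat) \<Rightarrow> bool" where
  "collision n D \<omega> \<longleftrightarrow> \<not> disjoint_family_on (\<lambda>i. issued_ids (\<omega> i) (D i)) {1..n}"

text \<open>\<^const>\<open>Pi_pmf\<close> makes the \<open>n\<close> draws independent; its default value \<^const>\<open>id\<close>
  is only taken at indices outside \<open>{1..n}\<close>.\<close>

definition collision_prob :: "(nat \<Rightarrow> nat) pmf \<Rightarrow> nat \<Rightarrow> (nat \<Rightarrow> nat) \<Rightarrow> real" where
  "collision_prob A n D =
     measure_pmf.prob (Pi_pmf {1..n} id (\<lambda>_. A)) {\<omega>. collision n D \<omega>}"

text \<open>The \<open>t\<close>-th ID is \<open>x + (t - 1)\<close>, reduced modulo \<open>m\<close> to a representative in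
  \<open>{1..m}\<close>; outside \<open>{1..m}\<close> the function is the identity, as
  \<^const>\<open>permutes\<close> demands.\<close>

definition cluster_perm :: "nat \<Rightarrow> nat \<Rightarrow> nat \<Rightarrow> nat" where
  "cluster_perm m x t =
     (if t \<in> {1..m} then ((x - 1) + (t - 1)) mod m + 1 else t)"

definition cluster :: "nat \<Rightarrow> (nat \<Rightarrow> nat) pmf" where
  "cluster m = map_pmf (cluster_perm m) (pmf_of_set {1..m})"

lemma cluster_perm_permutes: "cluster_perm m x permutes {1..m}"
proof (rule bij_imp_permutes)
  have inj: "inj_on (cluster_perm m x) {1..m}"
  proof (rule inj_onI)
    fix s t assume s: "s \<in> {1..m}" and t: "t \<in> {1..m}"
      and eq: "cluster_perm m x s = cluster_perm m x t"
    have "[(x - 1) + (s - 1) = (x - 1) + (t - 1)] (mod m)"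
      using s t eq by (simp add: cluster_perm_def cong_def)
    then have "[s - 1 = t - 1] (mod m)"
      by (simp only: cong_add_lcancel_nat)
    then have "s - 1 = t - 1"
      using s t by (auto simp: cong_def)
    then show "s = t" using s t by auto
  qed
  have "cluster_perm m x ` {1..m} \<subseteq> {1..m}"
    by (auto simp: cluster_perm_def Suc_le_eq)
  then show "bij_betw (cluster_perm m x) {1..m} {1..m}"
    using inj by (simp add: bij_betw_def endo_inj_surj)
qed (auto simp: cluster_perm_def)

lemma id_algorithm_cluster: "id_algorithm m (cluster m)" if "m \<ge> 1"
  using that cluster_perm_permutes by (auto simp del: One_nat_def simp: id_algorithm_def cluster_def)

end

theory Submission
  imports Defs
begin

text \<open>For the upper bound, two arcs of the cycle meet only if the first point of one of them lies in
  the other, which has probability at most \<open>d\<^sub>j / m\<close> for each ordered pair \<open>i \<noteq> j\<close>; sum over all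
  pairs. For the lower bound, draw the instances in order of decreasing demand. If no collision has
  occurred so far, the IDs already issued number \<open>S\<close>, the sum of the previous demands, and
  the next first ID avoids them with probability \<open>1 - S / m \<le> exp (- S / m)\<close>. Because of the
  decreasing order these sums \<open>S\<close> add up to at least \<open>(n - 1) \<parallel>D\<parallel>\<^sub>1 / 2\<close>, so the probability of no
  collision is at most \<open>exp (- (n - 1) \<parallel>D\<parallel>\<^sub>1 / (2 m))\<close>.\<close>

text \<open>Condition on the draws in \<open>I\<close>: by independence the draw at \<open>i\<close>
  may come last. Its conditional chance to land in \<open>X\<close> is at most \<open>c\<close> when
  \<open>f\<close> lies in \<open>B\<close>, and zero otherwise.\<close>

lemma prob_Pi_pmf_insert_le:
  fixes c :: real
  assumes fin: "finite I" and i: "i \<notin> I" and c: "c \<ge> 0"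
    and B: "\<And>f y. f \<in> set_pmf (Pi_pmf I dflt p) \<Longrightarrow> f(i := y) \<in> X \<Longrightarrow> f \<in> B"
    and le: "\<And>f. f \<in> set_pmf (Pi_pmf I dflt p) \<Longrightarrow> f \<in> B \<Longrightarrow>
      measure_pmf.prob (p i) {y. f(i := y) \<in> X} \<le> c"
  shows "measure_pmf.prob (Pi_pmf (insert i I) dflt p) X \<le> c * measure_pmf.prob (Pi_pmf I dflt p) B"
proof -
  let ?q = "Pi_pmf I dflt p"
  \<comment> \<open>The two independent draws are swapped, so that \<open>f\<close> is fixed when
    \<open>i\<close> is drawn.\<close>
  have eq: "Pi_pmf (insert i I) dflt p = bind_pmf ?q (\<lambda>f. map_pmf (\<lambda>y. f(i := y)) (p i))"
    unfolding Pi_pmf_insert'[OF fin i] map_pmf_def by (rule bind_commute_pmf)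
  have "emeasure (measure_pmf (Pi_pmf (insert i I) dflt p)) X
      = (\<integral>\<^sup>+f. emeasure (p i) {y. f(i := y) \<in> X} \<partial>?q)"
    unfolding eq emeasure_bind_pmf by (simp add: vimage_def)
  also have "\<dots> \<le> (\<integral>\<^sup>+f. ennreal c * indicator B f \<partial>?q)"
  proof (rule nn_integral_mono_AE, unfold AE_measure_pmf_iff, intro ballI)
    fix f assume f: "f \<in> set_pmf ?q"
    show "emeasure (p i) {y. f(i := y) \<in> X} \<le> ennreal c * indicator B f"
    proof (cases "f \<in> B")
      case True
      then show ?thesis
        using le[OF f True] by (simp add: measure_pmf.emeasure_eq_measure ennreal_leI)
    next
      case False
      then have "{y. f(i := y) \<in> X} = {}" using B[OF f] by auto
      then show ?thesis by simp
    qed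
  qed
  also have "\<dots> = ennreal c * emeasure (measure_pmf ?q) B"
    by (simp add: nn_integral_cmult)
  finally show ?thesis
    using c by (simp add: measure_pmf.emeasure_eq_measure flip: ennreal_mult)
qed

section \<open>Arcs of the cycle and their uniform first IDs\<close>

lemma permutes_Pi_pmf_cluster:
  assumes "finite I" "f \<in> set_pmf (Pi_pmf I id (\<lambda>_. cluster m))" "i \<in> I" "m \<ge> 1"
  shows "f i permutes {1..m}"
  using assms cluster_perm_permutes
  by (auto simp: set_Pi_pmf PiE_dflt_def cluster_def simp del: One_nat_def)

lemma card_issued_ids: "card (issued_ids \<pi> d) = d" if "\<pi> permutes A"
  unfolding issued_ids_def
  by (subst card_image) (auto intro: inj_on_subset permutes_inj[OF that])

lemma issued_ids_subset: "issued_ids \<pi> d \<subseteq> {1..m}" if "\<pi> permutes {1..m}" "d \<le> m"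
  using that permutes_image[OF that(1)] unfolding issued_ids_def
  by (metis atLeastatMost_subset_iff image_mono order_refl)

lemma first_id_cluster: "map_pmf (\<lambda>\<pi>. \<pi> 1) (cluster m) = pmf_of_set {1..m}" if "m \<ge> 1"
proof -
  have "map_pmf (\<lambda>\<pi>. \<pi> 1) (cluster m) = map_pmf (\<lambda>x. x) (pmf_of_set {1..m})"
    unfolding cluster_def map_pmf_comp
    using that by (intro map_pmf_cong) (auto simp: cluster_perm_def)
  then show ?thesis by simp
qed

lemma prob_first_id_cluster:
  assumes "m \<ge> 1" "S \<subseteq> {1..m}"
  shows "measure_pmf.prob (cluster m) {\<pi>. \<pi> 1 \<in> S} = real (card S) / real m"
proof -
  have "measure_pmf.prob (cluster m) {\<pi>. \<pi> 1 \<in> S}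
      = measure_pmf.prob (map_pmf (\<lambda>\<pi>. \<pi> 1) (cluster m)) S"
    by (simp add: vimage_def)
  also have "\<dots> = real (card S) / real m"
    unfolding first_id_cluster[OF assms(1)]
    using assms by (subst measure_pmf_of_set) (auto simp: Int_absorb1)
  finally show ?thesis .
qed

text \<open>Both arcs are traced back by \<open>s - 1\<close> steps from the common ID. As
  \<open>s\<close> is at most \<open>t\<close>, the first arc reaches its start no later than the
  second.\<close>

lemma cluster_perm_shift_back:
  assumes "s \<in> {1..t}" "t \<in> {1..m}" and eq: "cluster_perm m x s = cluster_perm m y t"
  shows "cluster_perm m x 1 = cluster_perm m y (t - s + 1)"
proof -
  have "[(x - 1) + (s - 1) = (y - 1) + (t - 1)] (mod m)"
    using assms by (simp add: cluster_perm_def cong_def)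
  moreover have "(y - 1) + (t - 1) = ((y - 1) + (t - s)) + (s - 1)"
    using assms by auto
  ultimately have "[x - 1 = (y - 1) + (t - s)] (mod m)"
    by (simp only: cong_add_rcancel_nat)
  then show ?thesis
    using assms by (auto simp: cluster_perm_def cong_def)
qed

text \<open>Trace both arcs back from a common ID: whichever reaches its start first does so inside
  the other arc.\<close>

lemma cluster_arcs_meet:
  assumes "\<pi> \<in> set_pmf (cluster m)" "\<sigma> \<in> set_pmf (cluster m)" "m \<ge> 1"
    and "a \<le> m" "b \<le> m" "issued_ids \<pi> a \<inter> issued_ids \<sigma> b \<noteq> {}"
  shows "\<pi> 1 \<in> issued_ids \<sigma> b \<or> \<sigma> 1 \<in> issued_ids \<pi> a"
proof -
  obtain x y where xy: "\<pi> = cluster_perm m x" "\<sigma> = cluster_perm m y"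
    using assms by (auto simp: cluster_def)
  obtain s t where st: "s \<in> {1..a}" "t \<in> {1..b}" "\<pi> s = \<sigma> t"
    using assms(6) unfolding issued_ids_def by blast
  show ?thesis
  proof (cases "s \<le> t")
    case True
    have "\<pi> 1 = \<sigma> (t - s + 1)" unfolding xy
      using True st xy assms by (intro cluster_perm_shift_back) auto
    moreover have "t - s + 1 \<in> {1..b}" using st True by auto
    ultimately show ?thesis unfolding issued_ids_def by blast
  next
    case False
    have "\<sigma> 1 = \<pi> (s - t + 1)" unfolding xy
      using False st xy assms by (intro cluster_perm_shift_back) auto
    moreover have "s - t + 1 \<in> {1..a}" using st False by auto
    ultimately show ?thesis unfolding issued_ids_def by blast
  qed
qed

section \<open>Upper bound by a union over ordered pairs\<close>

text \<open>Once all draws except that of \<open>i\<close> are fixed, the arc of \<open>j\<close> is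
  a fixed set of \<open>d\<close> IDs, and the first ID of \<open>i\<close> is still
  uniform.\<close>

lemma prob_first_id_in_arc_le:
  assumes fin: "finite I" and ij: "i \<in> I" "j \<in> I" "i \<noteq> j" and m: "m \<ge> 1" and d: "d \<le> m"
  shows "measure_pmf.prob (Pi_pmf I id (\<lambda>_. cluster m)) {\<omega>. \<omega> i 1 \<in> issued_ids (\<omega> j) d}
    \<le> real d / real m"
proof -
  have "measure_pmf.prob (Pi_pmf (insert i (I - {i})) id (\<lambda>_. cluster m))
          {\<omega>. \<omega> i 1 \<in> issued_ids (\<omega> j) d}
      \<le> real d / real m * measure_pmf.prob (Pi_pmf (I - {i}) id (\<lambda>_. cluster m)) UNIV"
  proof (rule prob_Pi_pmf_insert_le)
    fix f assume "f \<in> set_pmf (Pi_pmf (I - {i}) id (\<lambda>_. cluster m))"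
    then have p: "f j permutes {1..m}"
      using ij m fin by (intro permutes_Pi_pmf_cluster[where I = "I - {i}"]) auto
    show "measure_pmf.prob (cluster m) {y. f(i := y) \<in> {\<omega>. \<omega> i 1 \<in> issued_ids (\<omega> j) d}}
        \<le> real d / real m"
      using prob_first_id_cluster[OF m issued_ids_subset[OF p d]] ij card_issued_ids[OF p, of d]
      by simp
  qed (use fin in auto)
  then show ?thesis using ij by (simp add: insert_absorb)
qed

lemma collision_prob_cluster_le:
  assumes m: "m \<ge> 1" and D: "D \<in> {1..n} \<rightarrow> {1..m}"
  shows "collision_prob (cluster m) n D \<le> real n * real (\<Sum>i=1..n. D i) / real m"
proof -
  let ?P = "Pi_pmf {1..n} id (\<lambda>_. cluster m)"
  let ?E = "\<lambda>i j. {\<omega>. \<omega> i 1 \<in> issued_ids (\<omega> j) (D j)} :: (nat \<Rightarrow> nat \<Rightarrow> nat) set"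
  \<comment> \<open>Restricting to the support makes every \<open>\<omega> i\<close> a cyclic shift,
    as \<open>cluster_arcs_meet\<close> requires.\<close>
  have sub: "{\<omega>. collision n D \<omega>} \<inter> set_pmf ?P \<subseteq> (\<Union>i\<in>{1..n}. \<Union>j\<in>{1..n}-{i}. ?E i j)"
  proof
    fix \<omega> assume w: "\<omega> \<in> {\<omega>. collision n D \<omega>} \<inter> set_pmf ?P"
    then obtain i j where ij: "i \<in> {1..n}" "j \<in> {1..n}" "i \<noteq> j"
      "issued_ids (\<omega> i) (D i) \<inter> issued_ids (\<omega> j) (D j) \<noteq> {}"
      unfolding collision_def disjoint_family_on_def by blast
    have "\<omega> i \<in> set_pmf (cluster m)" "\<omega> j \<in> set_pmf (cluster m)"
      using w ij by (auto simp: set_Pi_pmf PiE_dflt_def)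
    moreover have "D i \<le> m" "D j \<le> m" using D ij(1,2) by auto
    ultimately have "\<omega> \<in> ?E i j \<or> \<omega> \<in> ?E j i"
      using cluster_arcs_meet[OF _ _ m _ _ ij(4)] by auto
    then show "\<omega> \<in> (\<Union>i\<in>{1..n}. \<Union>j\<in>{1..n}-{i}. ?E i j)"
      using ij(1-3) by blast
  qed
  have "collision_prob (cluster m) n D
      = measure_pmf.prob ?P ({\<omega>. collision n D \<omega>} \<inter> set_pmf ?P)"
    unfolding collision_prob_def by (simp add: measure_Int_set_pmf)
  also have "\<dots> \<le> measure_pmf.prob ?P (\<Union>i\<in>{1..n}. \<Union>j\<in>{1..n}-{i}. ?E i j)"
    using sub by (intro measure_pmf.finite_measure_mono) auto
  also have "\<dots> \<le> (\<Sum>i\<in>{1..n}. measure_pmf.prob ?P (\<Union>j\<in>{1..n}-{i}. ?E i j))"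
    by (rule measure_pmf.finite_measure_subadditive_finite) auto
  also have "\<dots> \<le> (\<Sum>i\<in>{1..n}. \<Sum>j\<in>{1..n}-{i}. measure_pmf.prob ?P (?E i j))"
    by (intro sum_mono measure_pmf.finite_measure_subadditive_finite) auto
  also have "\<dots> \<le> (\<Sum>i\<in>{1..n}. \<Sum>j\<in>{1..n}-{i}. real (D j) / real m)"
    using D m by (intro sum_mono prob_first_id_in_arc_le) auto
  \<comment> \<open>Adding the diagonal terms only increases the sum and gives it a closed
    form.\<close>
  also have "\<dots> \<le> (\<Sum>i\<in>{1..n}. \<Sum>j\<in>{1..n}. real (D j) / real m)"
    by (intro sum_mono sum_mono2) auto
  also have "\<dots> = real n * real (\<Sum>i=1..n. D i) / real m"
    by (simp flip: sum_divide_distrib)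
  finally show ?thesis .
qed

section \<open>Lower bound by drawing the instances in order of decreasing demand\<close>

lemma prob_no_collision_cluster_le:
  assumes "finite I" and m: "m \<ge> 1" and "D \<in> I \<rightarrow> {1..m}"
  shows "measure_pmf.prob (Pi_pmf I id (\<lambda>_. cluster m))
      {\<omega>. disjoint_family_on (\<lambda>i. issued_ids (\<omega> i) (D i)) I}
    \<le> exp (- ((real (card I) - 1) * real (\<Sum>i\<in>I. D i) / (2 * real m)))"
  using assms(1,3)
\<comment> \<open>The rule inserts elements by increasing rank, so the negated demand, taken in the
  integers, makes \<open>D k\<close> the least demand so far. The rule does not exclude
  \<open>k\<close> from \<open>I\<close>, hence the case split below.\<close>
proof (induction I rule: finite_ranking_induct[where f = "\<lambda>i. - int (D i)"])
  case empty
  show ?case by simp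
next
  case (insert k I)
  let ?q = "\<lambda>I. Pi_pmf I id (\<lambda>_. cluster m)"
  let ?G = "\<lambda>I. {\<omega>. disjoint_family_on (\<lambda>i. issued_ids (\<omega> i) (D i)) I}"
  define S where "S = (\<Sum>i\<in>I. D i)"
  have DI: "D \<in> I \<rightarrow> {1..m}" and Dk: "D k \<in> {1..m}" using insert.prems by auto
  show ?case
  proof (cases "k \<in> I")
    case True
    then show ?thesis using insert.IH DI by (simp add: insert_absorb)
  next
    case False
    \<comment> \<open>The maximum keeps the factor nonnegative when \<open>S\<close> exceeds
      \<open>m\<close>.\<close>
    define c where "c = max 0 (1 - real S / real m)"
    have "measure_pmf.prob (?q (insert k I)) (?G (insert k I)) \<le> c * measure_pmf.prob (?q I) (?G I)"
    proof (rule prob_Pi_pmf_insert_le)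
      fix f y assume "f(k := y) \<in> ?G (insert k I)"
      with False show "f \<in> ?G I"
        by (auto simp: disjoint_family_on_def fun_upd_def split: if_splits)
    next
      fix f assume f: "f \<in> set_pmf (?q I)" and G: "f \<in> ?G I"
      define U where "U = (\<Union>i\<in>I. issued_ids (f i) (D i))"
      have perm: "f i permutes {1..m}" if "i \<in> I" for i
        using permutes_Pi_pmf_cluster[OF insert.hyps(1) f that m] .
      have "U \<subseteq> {1..m}"
        unfolding U_def using DI perm by (intro UN_least issued_ids_subset) auto
      \<comment> \<open>The absence of collisions in \<open>I\<close> makes the union disjoint, so
        exactly \<open>S\<close> IDs are forbidden to the next first ID.\<close>
      moreover have "card U = (\<Sum>i\<in>I. card (issued_ids (f i) (D i)))"
        unfolding U_def using insert.hyps G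
        by (intro card_UN_disjoint) (auto simp: disjoint_family_on_def issued_ids_def)
      then have "card U = S"
        unfolding S_def by (simp add: card_issued_ids[OF perm])
      ultimately have "measure_pmf.prob (cluster m) {y. y 1 \<in> U} = real S / real m"
        using prob_first_id_cluster[OF m] by simp
      moreover have "measure_pmf.prob (cluster m) (- {y. y 1 \<in> U})
          = 1 - measure_pmf.prob (cluster m) {y. y 1 \<in> U}"
        using measure_pmf.prob_compl[of "{y. y 1 \<in> U}" "cluster m"] by (simp add: Compl_eq_Diff_UNIV)
      moreover have "{y. f(k := y) \<in> ?G (insert k I)} \<subseteq> - {y. y 1 \<in> U}"
      proof (intro subsetI ComplI)
        fix y assume y: "y \<in> {y. f(k := y) \<in> ?G (insert k I)}" and "y \<in> {y. y 1 \<in> U}"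
        then obtain i where i: "i \<in> I" "y 1 \<in> issued_ids (f i) (D i)" by (auto simp: U_def)
        have "y 1 \<in> issued_ids y (D k)" using Dk by (auto simp: issued_ids_def)
        moreover have "issued_ids y (D k) \<inter> issued_ids (f i) (D i) = {}"
          using disjoint_family_onD[of "\<lambda>j. issued_ids ((f(k := y)) j) (D j)" "insert k I" k i]
            y i False by auto
        ultimately show False using i by blast
      qed
      then have "measure_pmf.prob (cluster m) {y. f(k := y) \<in> ?G (insert k I)}
          \<le> measure_pmf.prob (cluster m) (- {y. y 1 \<in> U})"
        by (intro measure_pmf.finite_measure_mono) auto
      ultimately show "measure_pmf.prob (cluster m) {y. f(k := y) \<in> ?G (insert k I)} \<le> c"
        by (simp add: c_def)
    qed (use insert.hyps False in \<open>auto simp: c_def\<close>)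
    also have "\<dots> \<le> exp (- (real S / real m))
        * exp (- ((real (card I) - 1) * real S / (2 * real m)))"
    proof (rule mult_mono)
      show "c \<le> exp (- (real S / real m))"
        using exp_ge_add_one_self[of "- (real S / real m)"] by (simp add: c_def)
    next
      show "measure_pmf.prob (?q I) (?G I) \<le> exp (- ((real (card I) - 1) * real S / (2 * real m)))"
        using insert.IH[OF DI] unfolding S_def .
    qed simp_all
    also have "\<dots> = exp (- (((real (card I) + 1) * real S) / (2 * real m)))"
      using m by (simp add: field_simps flip: exp_add)
    also have "\<dots> \<le> exp (- ((real (card (insert k I)) - 1) * real (\<Sum>i\<in>insert k I. D i) / (2 * real m)))"
    proof -
      \<comment> \<open>Here the order of the draws enters: \<open>D k\<close> is at most the
        average of the previous demands.\<close>
      have "card I * D k \<le> S"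
        unfolding S_def using insert.hyps sum_bounded_below[of I "D k" D] by auto
      then have "real (card I) * real (D k) \<le> real S"
        by (metis of_nat_le_iff of_nat_mult)
      then have "real (card I) * (real (D k) + real S) \<le> (real (card I) + 1) * real S"
        by (simp add: algebra_simps)
      then show ?thesis
        using insert.hyps False by (auto simp: S_def[symmetric] intro!: divide_right_mono)
    qed
    finally show ?thesis .
  qed
qed

text \<open>With \<open>t\<close> the ratio inside the minimum, the exponent is at least
  \<open>t / 4\<close>, so the collision probability is at least \<open>t / (4 + t)\<close>. This
  increases in \<open>t\<close> and equals 1/5 at \<open>t = 1\<close>, whence the constant.\<close>

lemma collision_prob_cluster_ge:
  assumes m: "m \<ge> 1" and D: "D \<in> {1..n} \<rightarrow> {1..m}" and n: "n \<ge> 2"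
  shows "1 / 5 * min 1 (real n * real (\<Sum>i=1..n. D i) / real m) \<le> collision_prob (cluster m) n D"
proof -
  let ?P = "Pi_pmf {1..n} id (\<lambda>_. cluster m)"
  let ?N = "{\<omega>. disjoint_family_on (\<lambda>i. issued_ids (\<omega> i) (D i)) {1..n}}"
  define S where "S = real (\<Sum>i=1..n. D i)"
  define t where "t = real n * S / real m"
  have S: "S \<ge> 0" unfolding S_def by (rule of_nat_0_le_iff)
  have t: "t \<ge> 0" using S by (simp add: t_def)
  have "{\<omega>. collision n D \<omega>} = UNIV - ?N" by (auto simp: collision_def)
  then have "collision_prob (cluster m) n D = 1 - measure_pmf.prob ?P ?N"
    unfolding collision_prob_def using measure_pmf.prob_compl[of ?N ?P] by simp
  also have "\<dots> \<ge> 1 - exp (- ((real n - 1) * S / (2 * real m)))"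
    using prob_no_collision_cluster_le[OF _ m D] by (simp add: S_def)
  finally have 1: "collision_prob (cluster m) n D \<ge> 1 - exp (- ((real n - 1) * S / (2 * real m)))" .
  \<comment> \<open>For at least two instances, \<open>n - 1\<close> is at least
    \<open>n / 2\<close>.\<close>
  have "real n * S \<le> 2 * (real n - 1) * S" using n S by (intro mult_right_mono) auto
  then have "t / 4 \<le> (real n - 1) * S / (2 * real m)"
    using m by (simp add: t_def field_simps)
  then have 2: "exp (- ((real n - 1) * S / (2 * real m))) \<le> exp (- (t / 4))" by simp
  have "exp (- (t / 4)) \<le> 1 / (1 + t / 4)"
    using exp_ge_add_one_self[of "t / 4"] t by (simp add: exp_minus field_simps)
  moreover have "1 / 5 * min 1 t \<le> 1 - 1 / (1 + t / 4)"
  proof -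
    have "1 - 1 / (1 + t / 4) = t / (4 + t)" using t by (simp add: field_simps)
    moreover have "1 / 5 * min 1 t * (4 + t) \<le> t"
    proof (cases "t \<le> 1")
      case True
      have "t * t \<le> t" using mult_left_mono[OF True t] by simp
      then show ?thesis using True by (simp add: algebra_simps)
    qed simp
    ultimately show ?thesis using t by (simp add: pos_le_divide_eq)
  qed
  ultimately have "1 / 5 * min 1 t \<le> collision_prob (cluster m) n D" using 1 2 by linarith
  then show ?thesis unfolding t_def S_def .
qed

theorem theorem3p1:
  "\<exists>c C :: real. c > 0 \<and> C > 0 \<and>
     (\<forall>(m :: nat) (n :: nat) (D :: nat \<Rightarrow> nat).
        n \<ge> 2 \<longrightarrow> D \<in> {1..n} \<rightarrow> {1..m} \<longrightarrow>
          c * min 1 (real n * real (\<Sum>i=1..n. D i) / real m) \<le> collision_prob (cluster m) n D \<and>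
          collision_prob (cluster m) n D \<le> C * min 1 (real n * real (\<Sum>i=1..n. D i) / real m))"
proof (rule exI[of _ "1 / 5"], rule exI[of _ 1], intro conjI allI impI)
  fix m n :: nat and D :: "nat \<Rightarrow> nat"
  assume n: "n \<ge> 2" and D: "D \<in> {1..n} \<rightarrow> {1..m}"
  \<comment> \<open>A demand \<open>D 1\<close> in \<open>{1..m}\<close> forces \<open>m\<close> to
    be positive.\<close>
  have "1 \<in> {1..n}" using n by simp
  then have m: "m \<ge> 1" using D by fastforce
  show "1 / 5 * min 1 (real n * real (\<Sum>i=1..n. D i) / real m) \<le> collision_prob (cluster m) n D"
    by (rule collision_prob_cluster_ge[OF m D n])
  have "collision_prob (cluster m) n D \<le> 1"
    unfolding collision_prob_def by simp
  then show "collision_prob (cluster m) n D \<le> 1 * min 1 (real n * real (\<Sum>i=1..n. D i) / real m)"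
    using collision_prob_cluster_le[OF m D] by simp
qed auto

end
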